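(* For all $\beta_0,\beta_1,p\in(0,1)$ with \[ \beta_0\,\beta_1^{1-p}<p^{p}(1-p)^{1-p}, \] the nonuniform Markov geometric measure $\mu_{\beta_0,\beta_1,p}$ is singular with respect to Lebesgue measure on $\mathbb{R}$, with \[ \dim_H\mu_{\beta_0,\beta_1,p}\le \frac{p\log(p)+(1-p)\log(1-p)}{\log(\beta_0)+(1-p)\log(\beta_1)}. \]
   Context: For $p\in(0,1)$ let $(X_i)_{i\ge 1}$ be the Markov chain with states $0,1$, transition probabilities $p_{ab}=\mathrm{Prob}(X_{i+1}=b\mid X_i=a)$ given by $p_{00}=p$, $p_{01}=1-p$, $p_{10}=1$, $p_{11}=0$, and initial distribution $\mathrm{Prob}(X_1=0)=\frac{1}{2-p}$, $\mathrm{Prob}(X_1=1)=\frac{1-p}{2-p}$. Put $\hat X_i=\sum_{k=1}^{i}X_k$. For $\beta_0,\beta_1\in(0,1)$ let \[ S=\sum_{i=1}^{\infty}X_i\,\beta_1^{\hat X_i}\beta_0^{\,i-\hat X_i}. \] The nonuniform Markov geometric measure $\mu_{\beta_0,\beta_1,p}$ is the distribution of $S$, i.e. $\mu_{\beta_0,\beta_1,p}(B)=\mathrm{Prob}(S\in B)$ for Borel sets $B\subseteq\mathbb{R}$. A Borel probability measure $\mu$ on $\mathbb{R}$ is (totally) singular if there is a Borel set $B$ of Lebesgue measure zero with $\mu(B)=1$. Its Hausdorff dimension is $\dim_H\mu=\inf\{\dim_H A\mid \mu(A)=1\}$, where $\dim_H A$ is the Hausdorff dimension of $A\subseteq\mathbb{R}$.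 *)

theory Defs
  imports "HOL-Probability.Probability"
begin

section \<open>The Markov chain\<close>

fun trans_prob :: "real \<Rightarrow> nat \<Rightarrow> nat \<Rightarrow> real" where
  "trans_prob p 0 0 = p"
| "trans_prob p 0 (Suc 0) = 1 - p"
| "trans_prob p (Suc 0) 0 = 1"
| "trans_prob p _ _ = 0"

text \<open>The chain is indexed by \<open>i \<ge> 1\<close>; the value \<open>X 0\<close> is irrelevant. The last assumption
  is the Markov property: given any history of positive probability, the conditional law of the
  next state is the transition probability from the current state.\<close>

locale markov_chain01 = prob_space M for M :: "'a measure" +
  fixes X :: "nat \<Rightarrow> 'a \<Rightarrow> nat" and p :: real
  assumes state: "\<And>i. i \<ge> 1 \<Longrightarrow> X i \<in> M \<rightarrow>\<^sub>M count_space {0, 1}"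
    and initial0: "\<P>(\<omega> in M. X 1 \<omega> = 0) = 1 / (2 - p)"
    and initial1: "\<P>(\<omega> in M. X 1 \<omega> = 1) = (1 - p) / (2 - p)"
    and markov: "\<And>i x b. i \<ge> 1 \<Longrightarrow> b \<in> {0, 1} \<Longrightarrow>
      \<P>(\<omega> in M. \<forall>k\<in>{1..i}. X k \<omega> = x k) > 0 \<Longrightarrow>
      \<P>(\<omega> in M. X (Suc i) \<omega> = b \<bar> \<forall>k\<in>{1..i}. X k \<omega> = x k) = trans_prob p (x i) b"

section \<open>The nonuniform Markov geometric measure\<close>

definition partial_count :: "(nat \<Rightarrow> 'a \<Rightarrow> nat) \<Rightarrow> nat \<Rightarrow> 'a \<Rightarrow> nat" where
  "partial_count X i \<omega> = (\<Sum>k=1..i. X k \<omega>)"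

text \<open>The term at position \<open>j\<close> of the series is the one with index \<open>i = j + 1\<close>. For
  \<open>{0, 1}\<close>-valued \<open>X\<close> the subtraction on \<^typ>\<open>nat\<close> does not truncate.\<close>

definition geometric_sum :: "(nat \<Rightarrow> 'a \<Rightarrow> nat) \<Rightarrow> real \<Rightarrow> real \<Rightarrow> 'a \<Rightarrow> real" where
  "geometric_sum X \<beta>0 \<beta>1 \<omega> =
     (\<Sum>j. let i = Suc j in
        real (X i \<omega>) * \<beta>1 ^ partial_count X i \<omega> * \<beta>0 ^ (i - partial_count X i \<omega>))"

definition markov_geometric_measure ::
    "'a measure \<Rightarrow> (nat \<Rightarrow> 'a \<Rightarrow> nat) \<Rightarrow> real \<Rightarrow> real \<Rightarrow> real measure" where
  "markov_geometric_measure M X \<beta>0 \<beta>1 = distr M borel (geometric_sum X \<beta>0 \<beta>1)"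

section \<open>Singularity and Hausdorff dimension\<close>

definition lebesgue_singular :: "real measure \<Rightarrow> bool" where
  "lebesgue_singular \<mu> \<longleftrightarrow> (\<exists>B\<in>sets borel. emeasure lborel B = 0 \<and> emeasure \<mu> B = 1)"

text \<open>\<open>diam(U)\<^sup>s\<close> with the usual conventions \<open>0\<^sup>0 = 1\<close> for nonempty \<open>U\<close> and value \<open>0\<close> for
  the empty set; they have to be spelled out because \<open>0 powr 0 = 0\<close>.\<close>

definition diam_pow :: "real \<Rightarrow> 'a::metric_space set \<Rightarrow> real" where
  "diam_pow s U = (if U = {} then 0 else if s = 0 then 1 else diameter U powr s)"

text \<open>Boundedness is required separately because \<^const>\<open>diameter\<close> is unspecified on
  unbounded sets. Finite covers are included, padded by empty sets.\<close>

definition delta_covers :: "real \<Rightarrow> 'a::metric_space set \<Rightarrow> (nat \<Rightarrow> 'a set) set" where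
  "delta_covers \<delta> A = {U. A \<subseteq> (\<Union>i. U i) \<and> (\<forall>i. bounded (U i) \<and> diameter (U i) \<le> \<delta>)}"

definition hausdorff_outer_measure :: "real \<Rightarrow> 'a::metric_space set \<Rightarrow> ennreal" where
  "hausdorff_outer_measure s A =
     (SUP \<delta>\<in>{0<..}. INF U\<in>delta_covers \<delta> A. \<Sum>i. ennreal (diam_pow s (U i)))"

definition hausdorff_dim :: "'a::metric_space set \<Rightarrow> ereal" where
  "hausdorff_dim A = Inf {ereal s | s. s \<ge> 0 \<and> hausdorff_outer_measure s A = 0}"

definition measure_hausdorff_dim :: "'a::metric_space measure \<Rightarrow> ereal" where
  "measure_hausdorff_dim \<mu> = Inf {hausdorff_dim A | A. A \<in> sets \<mu> \<and> emeasure \<mu> A = 1}"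

section \<open>Well-definedness\<close>

context markov_chain01
begin

lemma X_in: "i \<ge> 1 \<Longrightarrow> \<omega> \<in> space M \<Longrightarrow> X i \<omega> \<in> {0, 1}"
  using measurable_space[OF state] by fastforce

lemma X_measurable: "i \<ge> 1 \<Longrightarrow> X i \<in> M \<rightarrow>\<^sub>M count_space UNIV"
  by (rule measurable_compose[OF state, of _ "\<lambda>x. x", simplified]) auto

lemma partial_count_le: "\<omega> \<in> space M \<Longrightarrow> partial_count X i \<omega> \<le> i"
proof -
  assume "\<omega> \<in> space M"
  then have "(\<Sum>k=1..i. X k \<omega>) \<le> (\<Sum>k=1..i. 1)"
    using X_in by (intro sum_mono) fastforce
  then show ?thesis by (simp add: partial_count_def)
qed

lemma geometric_sum_summable:
  assumes "\<omega> \<in> space M" and b: "\<beta>0 \<in> {0<..<1}" "\<beta>1 \<in> {0<..<1}"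
  shows "summable (\<lambda>j. let i = Suc j in
        real (X i \<omega>) * \<beta>1 ^ partial_count X i \<omega> * \<beta>0 ^ (i - partial_count X i \<omega>))"
proof (rule summable_comparison_test')
  let ?m = "max \<beta>0 \<beta>1"
  show "summable (\<lambda>j. ?m ^ Suc j)" using b by (auto simp: summable_geometric_iff max_def)
  fix j :: nat
  let ?c = "partial_count X (Suc j) \<omega>"
  have c: "?c \<le> Suc j" using assms partial_count_le by blast
  have x: "real (X (Suc j) \<omega>) \<le> 1" using X_in[of "Suc j" \<omega>] assms by auto
  have "\<beta>1 ^ ?c * \<beta>0 ^ (Suc j - ?c) \<le> ?m ^ ?c * ?m ^ (Suc j - ?c)"
    using b by (intro mult_mono power_mono) auto
  also have "\<dots> = ?m ^ Suc j" using c by (simp only: power_add[symmetric]) simp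
  finally have *: "\<beta>1 ^ ?c * \<beta>0 ^ (Suc j - ?c) \<le> ?m ^ Suc j" .
  have "real (X (Suc j) \<omega>) * (\<beta>1 ^ ?c * \<beta>0 ^ (Suc j - ?c)) \<le> 1 * (?m ^ Suc j)"
    using b by (intro mult_mono x *) auto
  then show "norm (let i = Suc j in
        real (X i \<omega>) * \<beta>1 ^ partial_count X i \<omega> * \<beta>0 ^ (i - partial_count X i \<omega>)) \<le> ?m ^ Suc j"
    using b by (simp add: Let_def mult.assoc)
qed

lemma geometric_sum_measurable: "geometric_sum X \<beta>0 \<beta>1 \<in> borel_measurable M"
proof -
  have [measurable]: "X k \<in> M \<rightarrow>\<^sub>M count_space UNIV" if "k \<ge> 1" for k using X_measurable that .
  have [measurable]: "partial_count X i \<in> M \<rightarrow>\<^sub>M count_space UNIV" for i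
    unfolding partial_count_def by measurable
  have [measurable]: "(\<lambda>\<omega>. real (X (Suc j) \<omega>) * \<beta>1 ^ partial_count X (Suc j) \<omega> *
      \<beta>0 ^ (Suc j - partial_count X (Suc j) \<omega>)) \<in> borel_measurable M" for j
    by measurable
  show ?thesis unfolding geometric_sum_def[abs_def] Let_def by measurable
qed

lemma prob_space_markov_geometric_measure:
  "prob_space (markov_geometric_measure M X \<beta>0 \<beta>1)"
  unfolding markov_geometric_measure_def by (rule prob_space_distr[OF geometric_sum_measurable])

end

text \<open>The chain exists for every \<open>p \<in> (0,1)\<close>: it is driven by independent coins.\<close>

fun coin_chain :: "nat \<Rightarrow> (nat \<Rightarrow> bool) \<Rightarrow> nat" where
  "coin_chain 0 \<omega> = 0"
| "coin_chain (Suc i) \<omega> = of_bool (coin_chain i \<omega> = 0 \<and> \<omega> (Suc i))"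

definition coins :: "real \<Rightarrow> (nat \<Rightarrow> bool) measure" where
  "coins p = (\<Pi>\<^sub>M i\<in>UNIV. measure_pmf (bernoulli_pmf (if i = 1 then (1 - p) / (2 - p) else 1 - p)))"

lemma markov_chain01_exists:
  assumes p: "p \<in> {0<..<1}"
  shows "markov_chain01 (coins p) coin_chain p"
proof -
  define q where "q = (\<lambda>i::nat. if i = 1 then (1 - p) / (2 - p) else 1 - p)"
  have q: "0 \<le> q i" "q i \<le> 1" for i using p by (auto simp: q_def divide_simps)
  interpret P: product_prob_space "\<lambda>i. measure_pmf (bernoulli_pmf (q i))" UNIV
    by unfold_locales
  have coins: "coins p = (\<Pi>\<^sub>M i\<in>UNIV. measure_pmf (bernoulli_pmf (q i)))"
    by (simp add: coins_def q_def)
  interpret C: prob_space "coins p" unfolding coins by (rule P.prob_space_axioms)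
  have sp: "space (coins p) = UNIV" by (simp add: coins space_PiM)
  define prev where "prev x k = (if k \<le> 1 then 0 else x (k - 1))" for x :: "nat \<Rightarrow> nat" and k :: nat
  define F where "F x k = {c. x k = of_bool (prev x k = 0 \<and> c)}" for x k
  have ball_insert_eq: "(\<forall>k\<in>insert a A. P k) \<longleftrightarrow> P a \<and> (\<forall>k\<in>A. P k)" for a :: nat and A P
    by auto
  have hist: "(\<forall>k\<in>{1..i}. coin_chain k \<omega> = x k) \<longleftrightarrow> (\<forall>k\<in>{1..i}. \<omega> k \<in> F x k)" for \<omega> x i
  proof (induction i)
    case (Suc i)
    show ?case
    proof (cases "\<forall>k\<in>{1..i}. coin_chain k \<omega> = x k")
      case True
      then have "coin_chain i \<omega> = prev x (Suc i)" by (auto simp: prev_def)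
      then have "coin_chain (Suc i) \<omega> = x (Suc i) \<longleftrightarrow> \<omega> (Suc i) \<in> F x (Suc i)"
        unfolding F_def mem_Collect_eq coin_chain.simps by metis
      moreover have "{1..Suc i} = insert (Suc i) {1..i}" by auto
      ultimately show ?thesis using Suc by (simp only: ball_insert_eq)
    next
      case False
      moreover have "{1..Suc i} = insert (Suc i) {1..i}" by auto
      ultimately show ?thesis using Suc by (simp only: ball_insert_eq) blast
    qed
  qed simp
  have prob: "C.prob {\<omega>\<in>space (coins p). \<forall>k\<in>{1..i}. coin_chain k \<omega> = x k}
      = (\<Prod>k=1..i. measure (bernoulli_pmf (q k)) (F x k))" for i x
  proof -
    have "{\<omega>\<in>space (coins p). \<forall>k\<in>{1..i}. coin_chain k \<omega> = x k} =
        prod_emb UNIV (\<lambda>i. measure_pmf (bernoulli_pmf (q i))) {1..i} (\<Pi>\<^sub>E k\<in>{1..i}. F x k)"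
      unfolding hist by (auto simp: sp prod_emb_def restrict_PiE_iff Pi_iff)
    then show ?thesis unfolding coins by (simp add: P.measure_PiM_emb)
  qed
  have F: "measure (bernoulli_pmf (q k)) (F x k) =
      (if prev x k = 0 then (if x k = 0 then 1 - q k else if x k = 1 then q k else 0)
       else of_bool (x k = 0))" for k x
  proof -
    have "F x k = (if prev x k = 0 then (if x k = 0 then {False} else if x k = 1 then {True} else {})
       else if x k = 0 then UNIV else {})"
      by (auto simp: F_def)
    then show ?thesis using q[of k] by (simp add: measure_pmf_single)
  qed
  show ?thesis
  proof (unfold_locales)
    fix i :: nat
    assume "1 \<le> i"
    have "Measurable.pred (coins p) (\<lambda>\<omega>. \<omega> k)" for k
      unfolding coins by measurable
    note [measurable] = this
    have "coin_chain j \<in> coins p \<rightarrow>\<^sub>M count_space UNIV" for j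
    proof (induction j)
      case (Suc j)
      note [measurable] = Suc
      show ?case unfolding coin_chain.simps[abs_def] by measurable
    qed (simp add: fun_eq_iff measurable_def)
    moreover have "coin_chain j \<omega> \<in> {0,1}" for j \<omega> by (cases j) auto
    ultimately show "coin_chain i \<in> coins p \<rightarrow>\<^sub>M count_space {0, 1}"
      by (subst measurable_count_space_eq2) (auto intro: measurable_sets simp del: insert_iff)
  next
    show "C.prob {\<omega>\<in>space (coins p). coin_chain 1 \<omega> = 0} = 1 / (2 - p)"
      using prob[of 1 "\<lambda>_. 0"] F[of 1 "\<lambda>_. 0"] p by (simp add: prev_def q_def field_simps)
  next
    show "C.prob {\<omega>\<in>space (coins p). coin_chain 1 \<omega> = 1} = (1 - p) / (2 - p)"
      using prob[of 1 "\<lambda>_. 1"] F[of 1 "\<lambda>_. 1"] p by (simp add: prev_def q_def field_simps)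
  next
    fix i b :: nat and x :: "nat \<Rightarrow> nat"
    assume i: "1 \<le> i" and b: "b \<in> {0,1}"
      and pos: "0 < C.prob {\<omega>\<in>space (coins p). \<forall>k\<in>{1..i}. coin_chain k \<omega> = x k}"
    define y where "y = x(Suc i := b)"
    have 1: "{\<omega>\<in>space (coins p). coin_chain (Suc i) \<omega> = b \<and> (\<forall>k\<in>{1..i}. coin_chain k \<omega> = x k)}
        = {\<omega>\<in>space (coins p). \<forall>k\<in>{1..Suc i}. coin_chain k \<omega> = y k}"
      by (auto simp: y_def atLeastAtMostSuc_conv)
    have 2: "F y k = F x k" if "k \<in> {1..i}" for k
      using that by (auto simp: F_def y_def prev_def)
    have "x i \<in> {0,1}"
    proof (rule ccontr)
      assume "x i \<notin> {0,1}"
      then have "F x i = {}" by (auto simp: F_def)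
      then have "(\<Prod>k=1..i. measure (bernoulli_pmf (q k)) (F x k)) = 0"
        using i by (intro prod_zero bexI[of _ i]) auto
      then show False using pos unfolding prob by linarith
    qed
    then have "measure (bernoulli_pmf (q (Suc i))) (F y (Suc i)) = trans_prob p (x i) b"
      unfolding F using i b by (auto simp: y_def prev_def q_def)
    moreover have "C.prob {\<omega>\<in>space (coins p). \<forall>k\<in>{1..Suc i}. coin_chain k \<omega> = y k} =
       C.prob {\<omega>\<in>space (coins p). \<forall>k\<in>{1..i}. coin_chain k \<omega> = x k} *
         measure (bernoulli_pmf (q (Suc i))) (F y (Suc i))"
      unfolding prob using 2 by simp
    ultimately show "\<P>(\<omega> in coins p. coin_chain (Suc i) \<omega> = b \<bar>
        \<forall>k\<in>{1..i}. coin_chain k \<omega> = x k) = trans_prob p (x i) b"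
      using pos unfolding cond_prob_def 1 by simp
  qed
qed

end

theory Submission
  imports Defs
begin

text \<open>The first \<open>n\<close> states form a word \<open>w\<close>, and they confine \<open>S\<close> to an interval whose length is a
  constant times \<open>\<beta>1\<^sup>c \<beta>0\<^sup>n\<^sup>-\<^sup>c\<close>, where \<open>c\<close> is the number of ones in \<open>w\<close>
  (\<open>geometric_sum_in_word_interval\<close>). The probability of \<open>w\<close>, if it is not \<open>0\<close>, is
  at least a constant times \<open>p\<^sup>n\<^sup>-\<^sup>2\<^sup>c (1 - p)\<^sup>c\<close> (\<open>word_prob_lower\<close>). These expressions depend only on
  \<open>n\<close> and \<open>c\<close>, and \<open>c / n\<close> tends to \<open>(1 - p) / (2 - p)\<close> in probability. So if \<open>s\<close> exceeds the claimed
  dimension bound, there is \<open>q < 1\<close> such that the words with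
  \<open>length\<^sup>s \<le> probability \<cdot> q\<^sup>n\<close> have total probability tending to \<open>1\<close> (\<open>bad_words_negligible\<close>).

  Call these words good. Over the good words of length \<open>n\<close>, the sum of \<open>length\<^sup>s\<close> is at most \<open>q\<^sup>n\<close>,
  simply because probabilities add up to at most \<open>1\<close>; no counting of words is needed, and overlaps
  of the intervals do no harm. Hence the set of points that lie in good intervals of arbitrarily
  high level is \<open>s\<close>-null (\<open>hausdorff_null_limsup\<close>), and it has full measure
  (\<open>full_measure_hausdorff_null\<close>). Letting \<open>s\<close> decrease to the bound gives the dimension estimate.
  The hypothesis says that the bound is less than \<open>1\<close>, so \<open>s = 1\<close> is admissible, and this gives
  singularity because sets that are null for the one-dimensional Hausdorff measure are Lebesgue null.

  The weak law for \<open>c / n\<close> is Chebyshev's inequality applied to the martingale with increments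
  \<open>X\<^sub>i\<^sub>+\<^sub>1 - (1 - p) (1 - X\<^sub>i)\<close> (\<open>second_moment_word_mart\<close>): its value differs by at most \<open>1\<close> from
  \<open>(2 - p) c - (1 - p) n\<close> (\<open>word_mart_approx\<close>).\<close>

section \<open>Hausdorff null sets\<close>

text \<open>The convergence half of the Borel-Cantelli lemma for Hausdorff measures: points covered at infinitely
  many levels form a null set if the \<open>s\<close>-sums of the levels are dominated by a geometric series.\<close>

lemma hausdorff_null_limsup:
  fixes I :: "'b::countable \<Rightarrow> 'a::metric_space set" and len :: "'b \<Rightarrow> nat"
  assumes fin: "\<And>n. finite {w\<in>G. len w = n}"
    and bdd: "\<And>w. w \<in> G \<Longrightarrow> bounded (I w)"
    and sum: "\<And>n. (\<Sum>w\<in>{w\<in>G. len w = n}. diam_pow s (I w)) \<le> q ^ n"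
    and q: "0 \<le> q" "q < 1"
    and diam: "\<And>w. w \<in> G \<Longrightarrow> diameter (I w) \<le> K * m ^ len w"
    and m: "0 \<le> m" "m < 1"
    and A: "\<And>N. A \<subseteq> (\<Union>w\<in>{w\<in>G. N \<le> len w}. I w)"
  shows "hausdorff_outer_measure s A = 0"
proof -
  have pos: "0 \<le> diam_pow s U" for U :: "'a set"
    by (simp add: diam_pow_def)
  have "(INF U\<in>delta_covers \<delta> A. \<Sum>i. ennreal (diam_pow s (U i))) \<le> 0" if \<delta>: "\<delta> > 0" for \<delta>
  proof (rule ennreal_le_epsilon)
    fix e :: real assume e: "e > 0"
    have "(\<lambda>n. K * m ^ n) \<longlonglongrightarrow> K * 0"
      using m by (intro tendsto_intros LIMSEQ_power_zero) auto
    then have "\<forall>\<^sub>F n in sequentially. K * m ^ n < \<delta>"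
      using \<delta> by (auto dest: order_tendstoD)
    moreover have "(\<lambda>n. q ^ n / (1 - q)) \<longlonglongrightarrow> 0 / (1 - q)"
      using q by (intro tendsto_intros LIMSEQ_power_zero) auto
    then have "\<forall>\<^sub>F n in sequentially. q ^ n / (1 - q) < e"
      using e by (auto dest: order_tendstoD)
    ultimately have "\<forall>\<^sub>F n in sequentially. K * m ^ n < \<delta> \<and> q ^ n / (1 - q) < e"
      by (rule eventually_conj)
    then obtain N where N: "\<And>n. n \<ge> N \<Longrightarrow> K * m ^ n < \<delta> \<and> q ^ n / (1 - q) < e"
      by (auto simp: eventually_sequentially)
    \<comment> \<open>The countably many indices of level at least \<open>N\<close> are enumerated by \<^const>\<open>to_nat\<close>; numbers that
      are not codes of such indices get the empty set.\<close>
    define J where "J = to_nat ` {w\<in>G. N \<le> len w}"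
    define U where "U i = (if i \<in> J then I (from_nat i) else {})" for i
    have U_to: "U (to_nat w) = I w" if "w \<in> G" "N \<le> len w" for w
      using that by (auto simp: U_def J_def)
    have "U \<in> delta_covers \<delta> A"
      unfolding delta_covers_def
    proof (intro CollectI conjI allI)
      show "A \<subseteq> (\<Union>i. U i)"
      proof
        fix x assume "x \<in> A"
        then obtain w where "w \<in> G" "N \<le> len w" "x \<in> I w" using A[of N] by blast
        then show "x \<in> (\<Union>i. U i)" using U_to by blast
      qed
      fix i
      show "bounded (U i)"
        using bdd by (auto simp: U_def J_def)
      have "diameter (I w) \<le> \<delta>" if "w \<in> G" "N \<le> len w" for w
        using diam[of w] N[of "len w"] that by simp
      then show "diameter (U i) \<le> \<delta>"
        using \<delta> by (auto simp: U_def J_def)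
    qed
    moreover have "(\<Sum>i. ennreal (diam_pow s (U i))) \<le> ennreal e"
    proof (rule suminf_le_const[OF summableI])
      fix k
      define F where "F = {w\<in>G. N \<le> len w \<and> to_nat w < k}"
      have JF: "{..<k} \<inter> J = to_nat ` F"
        by (auto simp: F_def J_def)
      have "finite (to_nat ` F)" unfolding JF[symmetric] by simp
      then have F: "finite F" "F \<subseteq> {w\<in>G. N \<le> len w}"
        by (auto simp: F_def dest!: finite_imageD)
      obtain N' where N': "\<And>w. w \<in> F \<Longrightarrow> len w < N'"
      proof
        fix w assume "w \<in> F"
        then show "len w < Suc (Max (len ` F))" using F by (simp add: less_Suc_eq_le)
      qed
      have "(\<Sum>i<k. diam_pow s (U i)) = (\<Sum>i\<in>{..<k} \<inter> J. diam_pow s (U i))"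
        by (rule sum.mono_neutral_right) (auto simp: U_def diam_pow_def)
      also have "\<dots> = (\<Sum>w\<in>F. diam_pow s (U (to_nat w)))"
        unfolding JF by (subst sum.reindex) auto
      also have "\<dots> = (\<Sum>w\<in>F. diam_pow s (I w))"
        using U_to F(2) by (intro sum.cong) auto
      also have "\<dots> \<le> (\<Sum>w\<in>(\<Union>n\<in>{N..<N'}. {w\<in>G. len w = n}). diam_pow s (I w))"
        using F N' by (intro sum_mono2 pos) (auto simp: fin)
      also have "\<dots> = (\<Sum>n\<in>{N..<N'}. \<Sum>w\<in>{w\<in>G. len w = n}. diam_pow s (I w))"
        by (rule sum.UNION_disjoint) (auto simp: fin)
      also have "\<dots> \<le> (\<Sum>n\<in>{N..<N'}. q ^ n)"
        by (intro sum_mono sum)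
      also have "\<dots> \<le> (\<Sum>n\<in>{N..<N + N'}. q ^ n)"
        using q by (intro sum_mono2) auto
      also have "\<dots> = q ^ N * (\<Sum>n<N'. q ^ n)"
        unfolding sum_distrib_left power_add[symmetric]
        by (rule sum.reindex_bij_witness[of _ "\<lambda>n. N + n" "\<lambda>n. n - N"]) auto
      also have "\<dots> = q ^ N * ((1 - q ^ N') / (1 - q))"
        using q by (simp add: sum_gp_strict)
      also have "\<dots> \<le> q ^ N * (1 / (1 - q))"
        using q by (intro mult_left_mono divide_right_mono) auto
      also have "\<dots> \<le> e" using N[of N] by simp
      finally show "(\<Sum>i<k. ennreal (diam_pow s (U i))) \<le> ennreal e"
        using pos by (simp add: sum_ennreal ennreal_leI)
    qed
    ultimately show "(INF U\<in>delta_covers \<delta> A. \<Sum>i. ennreal (diam_pow s (U i))) \<le> 0 + ennreal e"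
      by (auto intro: INF_lower2)
  qed
  then show ?thesis
    unfolding hausdorff_outer_measure_def by (auto intro!: antisym SUP_least)
qed

lemma hausdorff_null_imp_lborel_null:
  fixes A :: "real set"
  assumes A: "A \<in> sets borel" and null: "hausdorff_outer_measure 1 A = 0"
  shows "emeasure lborel A = 0"
proof -
  have "emeasure lborel A \<le> 0"
  proof (rule ennreal_le_epsilon)
    fix e :: real assume e: "e > 0"
    have "(INF U\<in>delta_covers 1 A. \<Sum>i. ennreal (diam_pow 1 (U i))) \<le> hausdorff_outer_measure 1 A"
      unfolding hausdorff_outer_measure_def by (rule SUP_upper) simp
    also have "\<dots> < ennreal (e / 2)" using null e by simp
    finally obtain U where U: "U \<in> delta_covers 1 A"
      and sum: "(\<Sum>i. ennreal (diam_pow 1 (U i))) < ennreal (e / 2)"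
      unfolding INF_less_iff by blast
    \<comment> \<open>The sets of the cover need not be measurable, so each one is replaced by an interval around
      one of its points, of at most twice the diameter.\<close>
    have "\<exists>B. B \<in> sets lborel \<and> U i \<subseteq> B \<and> emeasure lborel B \<le> 2 * ennreal (diam_pow 1 (U i))" for i
    proof (cases "U i = {}")
      case False
      then obtain x where x: "x \<in> U i" by blast
      have b: "bounded (U i)" using U by (simp add: delta_covers_def)
      then have d: "0 \<le> diameter (U i)" by (rule diameter_ge_0)
      have "U i \<subseteq> {x - diameter (U i)..x + diameter (U i)}"
      proof
        fix y assume "y \<in> U i"
        then have "dist x y \<le> diameter (U i)" using x b by (intro diameter_bounded_bound)
        then show "y \<in> {x - diameter (U i)..x + diameter (U i)}" by (auto simp: dist_real_def)
      qed
      moreover have "emeasure lborel {x - diameter (U i)..x + diameter (U i)} = 2 * ennreal (diam_pow 1 (U i))"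
        using d False by (simp add: diam_pow_def ennreal_mult'[symmetric] flip: ennreal_numeral)
      ultimately show ?thesis
        by (intro exI[of _ "{x - diameter (U i)..x + diameter (U i)}"]) simp
    qed auto
    then obtain B where B: "\<And>i. B i \<in> sets lborel" "\<And>i. U i \<subseteq> B i"
      "\<And>i. emeasure lborel (B i) \<le> 2 * ennreal (diam_pow 1 (U i))" by metis
    have "emeasure lborel A \<le> emeasure lborel (\<Union>i. B i)"
    proof (rule emeasure_mono)
      have "A \<subseteq> (\<Union>i. U i)" using U by (simp add: delta_covers_def)
      then show "A \<subseteq> (\<Union>i. B i)" using B(2) by blast
    qed (use B(1) in auto)
    also have "\<dots> \<le> (\<Sum>i. emeasure lborel (B i))"
      using B by (intro emeasure_subadditive_countably) auto
    also have "\<dots> \<le> (\<Sum>i. 2 * ennreal (diam_pow 1 (U i)))"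
      by (intro suminf_le B summableI)
    also have "\<dots> = 2 * (\<Sum>i. ennreal (diam_pow 1 (U i)))" by simp
    also have "\<dots> \<le> 2 * ennreal (e / 2)" using sum by (intro mult_left_mono) auto
    also have "\<dots> = ennreal e" using e by (simp add: ennreal_mult'[symmetric] flip: ennreal_numeral)
    finally show "emeasure lborel A \<le> 0 + ennreal e" by simp
  qed
  then show ?thesis by simp
qed

section \<open>Words and their probabilities\<close>

text \<open>Words of length \<open>n\<close> over \<open>{0, 1}\<close>. Throughout, a word lists the states of the chain with the latest
  state first, so that a step of the chain is a \<open>Cons\<close>.\<close>

definition words :: "nat \<Rightarrow> nat list set" where
  "words n = {w. set w \<subseteq> {0, 1} \<and> length w = n}"

lemma finite_words [simp]: "finite (words n)"
  unfolding words_def by (rule finite_lists_length_eq) simp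

lemma sum_words_Suc:
  "(\<Sum>w\<in>words (Suc n). f w) = (\<Sum>w\<in>words n. f (0 # w) + (f (1 # w) :: real))"
proof -
  have *: "words (Suc n) = (#) 0 ` words n \<union> (#) 1 ` words n"
    by (auto simp: words_def length_Suc_conv image_iff)
  have "(\<Sum>w\<in>words (Suc n). f w) = (\<Sum>w\<in>(#) 0 ` words n. f w) + (\<Sum>w\<in>(#) 1 ` words n. f w)"
    unfolding * by (rule sum.union_disjoint) auto
  then show ?thesis by (simp add: sum.reindex sum.distrib)
qed

text \<open>The probability that the chain starts with the given word.\<close>

fun word_prob :: "real \<Rightarrow> nat list \<Rightarrow> real" where
  "word_prob p [] = 1"
| "word_prob p [a] = (if a = 0 then 1 / (2 - p) else (1 - p) / (2 - p))"
| "word_prob p (b # a # w) = word_prob p (a # w) * trans_prob p a b"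

text \<open>The sum of the martingale increments \<open>X\<^sub>i\<^sub>+\<^sub>1 - (1 - p) (1 - X\<^sub>i)\<close> along the word. Given \<open>X\<^sub>i = a\<close>,
  the conditional mean of \<open>X\<^sub>i\<^sub>+\<^sub>1\<close> is \<open>(1 - p) (1 - a)\<close>.\<close>

fun word_mart :: "real \<Rightarrow> nat list \<Rightarrow> real" where
  "word_mart p [] = 0"
| "word_mart p [a] = 0"
| "word_mart p (b # a # w) = word_mart p (a # w) + (real b - (1 - p) * (1 - real a))"

context
  fixes p :: real
  assumes p: "p \<in> {0<..<1}"
begin

lemma word_prob_nonneg: "set w \<subseteq> {0, 1} \<Longrightarrow> 0 \<le> word_prob p w"
  using p by (induction p w rule: word_prob.induct) auto

lemma sum_word_prob: "(\<Sum>w\<in>words n. word_prob p w) = 1"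
proof (induction n)
  case 0
  have "words 0 = {[]}" by (auto simp: words_def)
  then show ?case by simp
next
  case (Suc n)
  have "word_prob p (0 # w) + word_prob p (1 # w) = word_prob p w" if "w \<in> words n" for w
    using that p by (cases w) (auto simp: words_def field_simps)
  then show ?case using Suc by (simp add: sum_words_Suc)
qed

text \<open>The increments are centred given the past and bounded by \<open>1\<close>, so each step adds at most \<open>1\<close> to the
  second moment.\<close>

lemma second_moment_word_mart: "(\<Sum>w\<in>words n. word_prob p w * (word_mart p w)\<^sup>2) \<le> real n"
proof (induction n)
  case 0
  have "words 0 = {[]}" by (auto simp: words_def)
  then show ?case by simp
next
  case (Suc n)
  have *: "word_prob p (0 # w) * (word_mart p (0 # w))\<^sup>2 + word_prob p (1 # w) * (word_mart p (1 # w))\<^sup>2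
      \<le> word_prob p w * (word_mart p w)\<^sup>2 + word_prob p w" if w: "w \<in> words n" for w
  proof (cases w)
    case Nil
    then show ?thesis by simp
  next
    case (Cons a v)
    have a: "a = 0 \<or> a = 1" and v: "0 \<le> word_prob p w"
      using w Cons word_prob_nonneg[of w] by (auto simp: words_def)
    from a have "trans_prob p a 0 * (word_mart p (0 # w))\<^sup>2 + trans_prob p a 1 * (word_mart p (1 # w))\<^sup>2
      \<le> (word_mart p w)\<^sup>2 + 1"
    proof
      assume "a = 0"
      then have "trans_prob p a 0 * (word_mart p (0 # w))\<^sup>2 + trans_prob p a 1 * (word_mart p (1 # w))\<^sup>2
         = (word_mart p w)\<^sup>2 + p * (1 - p)"
        by (simp add: Cons power2_eq_square algebra_simps)
      also have "p * (1 - p) \<le> 1 * 1" using p by (intro mult_mono) auto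
      finally show ?thesis by simp
    qed (simp add: Cons)
    then have "word_prob p w * (trans_prob p a 0 * (word_mart p (0 # w))\<^sup>2 + trans_prob p a 1 * (word_mart p (1 # w))\<^sup>2)
      \<le> word_prob p w * ((word_mart p w)\<^sup>2 + 1)" using v by (rule mult_left_mono)
    then show ?thesis by (simp add: Cons algebra_simps)
  qed
  have "(\<Sum>w\<in>words (Suc n). word_prob p w * (word_mart p w)\<^sup>2)
      \<le> (\<Sum>w\<in>words n. word_prob p w * (word_mart p w)\<^sup>2 + word_prob p w)"
    unfolding sum_words_Suc by (intro sum_mono *)
  also have "\<dots> \<le> real (Suc n)" using Suc by (simp add: sum.distrib sum_word_prob)
  finally show ?case .
qed

lemma word_mart_eq:
  "w \<noteq> [] \<Longrightarrow> word_mart p w = (2 - p) * real (sum_list w) - (1 - p) * real (length w)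
     + (1 - p) * (1 - real (hd w)) - real (last w)"
  by (induction p w rule: word_mart.induct) (auto simp: algebra_simps)

lemma word_mart_approx:
  assumes "set w \<subseteq> {0, 1}"
  shows "\<bar>word_mart p w - ((2 - p) * real (sum_list w) - (1 - p) * real (length w))\<bar> \<le> 1"
proof (cases "w = []")
  case False
  then have "hd w \<in> {0, 1}" "last w \<in> {0, 1}" using assms hd_in_set last_in_set by blast+
  then show ?thesis using p by (auto simp: word_mart_eq[OF False])
qed simp

text \<open>Every \<open>1\<close> but a final one is followed by a \<open>0\<close> with probability \<open>1\<close>; so a word with \<open>c\<close> ones has about
  \<open>c\<close> transitions from \<open>0\<close> to \<open>1\<close> and \<open>n - 2 c\<close> from \<open>0\<close> to \<open>0\<close>. The factor \<open>p\<close> for words ending in \<open>1\<close>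
  corrects for the step back to \<open>0\<close> that has not yet occurred, and makes the induction an equality at
  each step.\<close>

lemma word_prob_lower:
  assumes "w \<noteq> []" "set w \<subseteq> {0, 1}" "0 < word_prob p w"
  shows "word_prob p w \<ge> (if hd w = 1 then p else 1) / (2 - p) *
    exp ((real (length w) - 2 * real (sum_list w)) * ln p + real (sum_list w) * ln (1 - p))"
  using assms
proof (induction w rule: induct_list012)
  case (2 a)
  then have "a = 0 \<or> a = 1" by auto
  then show ?case
  proof
    assume "a = 1"
    then show ?case using p by (simp add: exp_diff)
  qed (use p in \<open>simp add: divide_right_mono\<close>)
next
  case (3 b a w)
  let ?E = "\<lambda>w. exp ((real (length w) - 2 * real (sum_list w)) * ln p + real (sum_list w) * ln (1 - p))"
  have ab: "a = 0 \<or> a = 1" "b = 0 \<or> b = 1" using 3 by auto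
  have pos: "0 < word_prob p (a # w)"
    using 3 word_prob_nonneg[of "a # w"] by (auto simp: zero_less_mult_iff less_le)
  have IH: "word_prob p (a # w) \<ge> (if a = 1 then p else 1) / (2 - p) * ?E (a # w)"
    using 3 pos by simp
  have t: "trans_prob p a b > 0" using 3 pos by (simp add: zero_less_mult_iff)
  have E0: "?E (0 # v) = ?E v * p" for v
  proof -
    have "?E (0 # v) = exp (((real (length v) - 2 * real (sum_list v)) * ln p + real (sum_list v) * ln (1 - p))
         + ln p)" by (simp add: algebra_simps)
    then show ?thesis using p by (subst (asm) exp_add) simp
  qed
  have E1: "?E (1 # v) * p = ?E v * (1 - p)" for v
  proof -
    have "?E (1 # v) = exp (((real (length v) - 2 * real (sum_list v)) * ln p + real (sum_list v) * ln (1 - p))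
         + ln (1 - p) + - ln p)" by (simp add: algebra_simps)
    also have "\<dots> = ?E v * (1 - p) / p"
      using p by (subst exp_add, subst exp_add, subst exp_minus) (simp add: field_simps)
    finally show ?thesis using p by simp
  qed
  have "(if b = 1 then p else 1) / (2 - p) * ?E (b # a # w)
      = (if a = 1 then p else 1) / (2 - p) * ?E (a # w) * trans_prob p a b"
    using ab
  proof (elim disjE)
    assume "a = 0" "b = 0"
    then show ?thesis using E0[of "a # w"] by simp
  next
    assume "a = 0" "b = 1"
    then show ?thesis using E1[of "a # w"] by (simp add: mult.commute)
  next
    assume "a = 1" "b = 0"
    then show ?thesis using E0[of "a # w"] by (simp add: mult.commute)
  next
    assume "a = 1" "b = 1"
    then show ?thesis using t by simp
  qed
  also have "\<dots> \<le> word_prob p (a # w) * trans_prob p a b"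
    using IH t by (intro mult_right_mono) auto
  finally show ?case by simp
qed simp

end


section \<open>Words as basic intervals\<close>

text \<open>The product of one factor \<open>\<beta>1\<close> for each \<open>1\<close> and one factor \<open>\<beta>0\<close> for each other letter.\<close>

fun word_radius :: "real \<Rightarrow> real \<Rightarrow> nat list \<Rightarrow> real" where
  "word_radius \<beta>0 \<beta>1 [] = 1"
| "word_radius \<beta>0 \<beta>1 (b # w) = (if b = 1 then \<beta>1 else \<beta>0) * word_radius \<beta>0 \<beta>1 w"

text \<open>The partial sum of the series for \<open>S\<close> determined by a word.\<close>

fun word_offset :: "real \<Rightarrow> real \<Rightarrow> nat list \<Rightarrow> real" where
  "word_offset \<beta>0 \<beta>1 [] = 0"
| "word_offset \<beta>0 \<beta>1 (b # w) = word_offset \<beta>0 \<beta>1 w + real b * word_radius \<beta>0 \<beta>1 (b # w)"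

text \<open>With \<open>m = max \<beta>0 \<beta>1\<close>, the tail of the series after a word of radius \<open>r\<close> is at most
  \<open>r (m + m\<^sup>2 + \<dots>)\<close>. The larger constant \<open>1 + m + m\<^sup>2 + \<dots> = 1 / (1 - m)\<close> still makes the intervals nested.\<close>

definition tail_const :: "real \<Rightarrow> real \<Rightarrow> real" where
  "tail_const \<beta>0 \<beta>1 = 1 / (1 - max \<beta>0 \<beta>1)"

text \<open>A closed interval that contains every value of \<open>S\<close> compatible with the word.\<close>

definition word_interval :: "real \<Rightarrow> real \<Rightarrow> nat list \<Rightarrow> real set" where
  "word_interval \<beta>0 \<beta>1 w =
     {word_offset \<beta>0 \<beta>1 w .. word_offset \<beta>0 \<beta>1 w + tail_const \<beta>0 \<beta>1 * word_radius \<beta>0 \<beta>1 w}"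

lemma sum_list_word_le: "set w \<subseteq> {0, 1} \<Longrightarrow> sum_list w \<le> length w"
  by (induction w) auto

lemma word_radius_eq:
  "set w \<subseteq> {0, 1} \<Longrightarrow>
    word_radius \<beta>0 \<beta>1 w = \<beta>1 ^ sum_list w * \<beta>0 ^ (length w - sum_list w)"
  by (induction w) (auto simp: Suc_diff_le sum_list_word_le)

context
  fixes \<beta>0 \<beta>1 :: real
  assumes \<beta>: "\<beta>0 \<in> {0<..<1}" "\<beta>1 \<in> {0<..<1}"
begin

lemma word_radius_pos: "0 < word_radius \<beta>0 \<beta>1 w"
  using \<beta> by (induction w) auto

lemma word_radius_le: "word_radius \<beta>0 \<beta>1 w \<le> max \<beta>0 \<beta>1 ^ length w"
proof (induction w)
  case (Cons b w)
  then show ?case using \<beta> word_radius_pos[of w]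
    by (auto intro!: mult_mono simp: less_imp_le)
qed simp

lemma tail_const_pos: "0 < tail_const \<beta>0 \<beta>1"
  using \<beta> by (simp add: tail_const_def)

lemma word_interval_Cons:
  assumes "b \<in> {0, 1}"
  shows "word_interval \<beta>0 \<beta>1 (b # w) \<subseteq> word_interval \<beta>0 \<beta>1 w"
proof -
  define m where "m = max \<beta>0 \<beta>1"
  define C where "C = tail_const \<beta>0 \<beta>1"
  define c where "c = (if b = 1 then \<beta>1 else \<beta>0)"
  have m: "0 < m" "m < 1" and c: "0 < c" "c \<le> m" and C: "0 < C" and CE: "C = 1 / (1 - m)"
    using \<beta> tail_const_pos by (auto simp: m_def C_def c_def tail_const_def)
  have "(real b + C) * c \<le> (1 + C) * m"
    using assms c C by (intro mult_mono) auto
  also have "\<dots> \<le> C"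
  proof -
    have "C * (1 - m) = 1" using m by (simp add: CE)
    then show ?thesis using m by (simp add: algebra_simps)
  qed
  finally have "(real b + C) * c * word_radius \<beta>0 \<beta>1 w \<le> C * word_radius \<beta>0 \<beta>1 w"
    using word_radius_pos[of w] by (intro mult_right_mono) auto
  moreover have "0 \<le> real b * (c * word_radius \<beta>0 \<beta>1 w)"
    using c word_radius_pos[of w] by simp
  moreover have "word_radius \<beta>0 \<beta>1 (b # w) = c * word_radius \<beta>0 \<beta>1 w"
    by (simp add: c_def)
  ultimately show ?thesis
    by (simp add: word_interval_def C_def[symmetric] algebra_simps del: word_radius.simps)
qed

lemma diameter_word_interval:
  "diameter (word_interval \<beta>0 \<beta>1 w) = tail_const \<beta>0 \<beta>1 * word_radius \<beta>0 \<beta>1 w"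
  using mult_pos_pos[OF tail_const_pos word_radius_pos[of w]] by (simp add: word_interval_def)

lemma diam_pow_word_interval:
  "s > 0 \<Longrightarrow> diam_pow s (word_interval \<beta>0 \<beta>1 w) = (tail_const \<beta>0 \<beta>1 * word_radius \<beta>0 \<beta>1 w) powr s"
  using mult_pos_pos[OF tail_const_pos word_radius_pos[of w]]
  by (simp add: diam_pow_def diameter_word_interval) (simp add: word_interval_def)

text \<open>This is where the exponent enters. Put \<open>\<eta> = p ln p + (1 - p) ln (1 - p) - s (ln \<beta>0 + (1 - p) ln \<beta>1)\<close>,
  which is positive by assumption. When \<open>c / n\<close> is near \<open>(1 - p) / (2 - p)\<close>, the logarithm of
  \<open>length\<^sup>s / probability\<close> is about \<open>- n \<eta> / (2 - p)\<close>; a quarter of this is kept as the decay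
  rate of \<open>q\<^sup>n\<close>, and the rest absorbs the deviation of \<open>c / n\<close> and the constants.\<close>

lemma bad_words_negligible:
  assumes p: "p \<in> {0<..<1}"
    and s: "s * (ln \<beta>0 + (1 - p) * ln \<beta>1) < p * ln p + (1 - p) * ln (1 - p)"
    and C: "C > 0"
  obtains q where "0 < q" "q < 1"
    "(\<lambda>n. \<Sum>w\<in>{w\<in>words n. \<not> (C * word_radius \<beta>0 \<beta>1 w) powr s \<le> word_prob p w * q ^ n}. word_prob p w)
       \<longlonglongrightarrow> 0"
proof -
  define l0 l1 lp lq where l: "l0 = ln \<beta>0" "l1 = ln \<beta>1" "lp = ln p" "lq = ln (1 - p)"
  define \<eta> where "\<eta> = p * lp + (1 - p) * lq - s * (l0 + (1 - p) * l1)"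
  \<comment> \<open>Up to bounded terms, \<open>ln (length\<^sup>s / probability)\<close> is affine in \<open>n\<close> and \<open>c\<close>, and \<open>B\<close> is the
    coefficient of \<open>c\<close>. A deviation of the martingale by \<open>\<delta> n\<close> changes \<open>2 - p\<close> times this logarithm by
    at most \<open>\<eta> n / 4\<close>. The bounded terms are collected in \<open>K\<close>.\<close>
  define B where "B = s * l1 - s * l0 + 2 * lp - lq"
  define K where "K = (2 - p) * (s * ln C - lp + ln (2 - p)) + \<bar>B\<bar>"
  define \<epsilon> where "\<epsilon> = \<eta> / (4 * (2 - p))"
  define \<delta> where "\<delta> = \<eta> / (4 * (\<bar>B\<bar> + 1))"
  have \<eta>: "\<eta> > 0" using s by (simp add: \<eta>_def l)
  have \<epsilon>: "\<epsilon> > 0" "(2 - p) * \<epsilon> = \<eta> / 4"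
  proof -
    show "\<epsilon> > 0" using \<eta> p by (simp add: \<epsilon>_def)
    have "2 - p \<noteq> 0" using p by auto
    then show "(2 - p) * \<epsilon> = \<eta> / 4" unfolding \<epsilon>_def by (simp only: times_divide_eq_right mult.commute[of 4]) (metis divide_divide_eq_left nonzero_mult_div_cancel_left)
  qed
  have \<delta>: "\<delta> > 0" using \<eta> by (simp add: \<delta>_def add_nonneg_pos)
  have "\<bar>B\<bar> * \<delta> \<le> (\<bar>B\<bar> + 1) * \<delta>" using \<delta> by (intro mult_right_mono) auto
  also have "\<dots> = \<eta> / 4"
    by (simp add: \<delta>_def field_simps abs_if)
  finally have B\<delta>: "\<bar>B\<bar> * \<delta> \<le> \<eta> / 4" .
  define q where "q = exp (- \<epsilon>)"
  have typical: "(C * word_radius \<beta>0 \<beta>1 w) powr s \<le> word_prob p w * q ^ n"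
    if w: "w \<in> words n" and n: "2 * K / \<eta> \<le> real n" "0 < n" and pos: "0 < word_prob p w"
      and mart: "\<bar>word_mart p w\<bar> < \<delta> * real n" for w n
  proof -
    define c where "c = real (sum_list w)"
    have ws: "set w \<subseteq> {0, 1}" "length w = n" "w \<noteq> []" using w n by (auto simp: words_def)
    have le: "sum_list w \<le> n" using sum_list_word_le ws by blast
    have "\<bar>(2 - p) * c - (1 - p) * real n\<bar> \<le> \<delta> * real n + 1"
      using word_mart_approx[OF p ws(1)] mart by (simp add: ws c_def)
    then have "\<bar>B\<bar> * \<bar>(2 - p) * c - (1 - p) * real n\<bar> \<le> \<bar>B\<bar> * (\<delta> * real n + 1)"
      by (intro mult_left_mono) auto
    also have "\<dots> \<le> \<eta> / 4 * real n + \<bar>B\<bar>"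
      using mult_right_mono[OF B\<delta>, of "real n"] by (simp add: algebra_simps)
    finally have "B * ((2 - p) * c - (1 - p) * real n) \<le> \<eta> / 4 * real n + \<bar>B\<bar>"
      by (metis abs_mult abs_ge_self order_trans)
    moreover have "K \<le> \<eta> / 2 * real n" using n \<eta> by (simp add: field_simps)
    moreover have "(2 - p) * (s * (ln C + (c * l1 + (real n - c) * l0))
        - (lp - ln (2 - p) + ((real n - 2 * c) * lp + c * lq) - \<epsilon> * real n))
      = K - \<bar>B\<bar> - \<eta> * real n + B * ((2 - p) * c - (1 - p) * real n) + ((2 - p) * \<epsilon>) * real n"
      by (simp add: K_def \<eta>_def B_def algebra_simps)
    ultimately have "(2 - p) * (s * (ln C + (c * l1 + (real n - c) * l0))
        - (lp - ln (2 - p) + ((real n - 2 * c) * lp + c * lq) - \<epsilon> * real n)) \<le> 0"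
      unfolding \<epsilon>(2) by (simp add: field_simps)
    then have main: "s * (ln C + (c * l1 + (real n - c) * l0))
        \<le> lp - ln (2 - p) + ((real n - 2 * c) * lp + c * lq) - \<epsilon> * real n"
      using p by (auto simp: mult_le_0_iff)
    have "ln (C * word_radius \<beta>0 \<beta>1 w) = ln C + (c * l1 + (real n - c) * l0)"
    proof -
      have "word_radius \<beta>0 \<beta>1 w = \<beta>1 ^ sum_list w * \<beta>0 ^ (n - sum_list w)"
        using word_radius_eq[OF ws(1)] ws(2) by simp
      then show ?thesis
        using \<beta> C le by (simp add: c_def l ln_mult ln_realpow of_nat_diff)
    qed
    then have "(C * word_radius \<beta>0 \<beta>1 w) powr s = exp (s * (ln C + (c * l1 + (real n - c) * l0)))"
      using C word_radius_pos[of w] by (simp add: powr_def)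
    also have "\<dots> \<le> exp (lp - ln (2 - p) + ((real n - 2 * c) * lp + c * lq) - \<epsilon> * real n)"
      using main by simp
    also have "\<dots> = p / (2 - p) * exp ((real n - 2 * c) * lp + c * lq) * q ^ n"
    proof -
      have "q ^ n = exp (- (\<epsilon> * real n))"
        by (simp add: q_def exp_of_nat_mult[symmetric] mult.commute)
      then show ?thesis using p by (simp only: l exp_add exp_diff exp_minus) (simp add: divide_inverse)
    qed
    also have "\<dots> \<le> word_prob p w * q ^ n"
    proof (rule mult_right_mono)
      have "p / (2 - p) * exp ((real n - 2 * c) * lp + c * lq)
          \<le> (if hd w = 1 then p else 1) / (2 - p) * exp ((real n - 2 * c) * lp + c * lq)"
        using p by (intro mult_right_mono divide_right_mono) auto
      also have "\<dots> \<le> word_prob p w"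
        using word_prob_lower[OF p ws(3,1) pos] by (simp add: ws c_def l)
      finally show "p / (2 - p) * exp ((real n - 2 * c) * lp + c * lq) \<le> word_prob p w" .
    qed (simp add: q_def)
    finally show ?thesis .
  qed
  let ?bad = "\<lambda>n. {w\<in>words n. \<not> (C * word_radius \<beta>0 \<beta>1 w) powr s \<le> word_prob p w * q ^ n}"
  have bound: "(\<Sum>w\<in>?bad n. word_prob p w) \<le> 1 / \<delta>\<^sup>2 / real n"
    if n: "2 * K / \<eta> \<le> real n" "0 < n" for n
  proof -
    have "(\<Sum>w\<in>?bad n. word_prob p w) \<le> (\<Sum>w\<in>?bad n. word_prob p w * (word_mart p w)\<^sup>2 / (\<delta> * real n)\<^sup>2)"
    proof (rule sum_mono)
      \<comment> \<open>A bad word of positive probability is atypical, by \<open>typical\<close>.\<close>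
      fix w assume w: "w \<in> ?bad n"
      have nn: "0 \<le> word_prob p w" using w word_prob_nonneg[OF p] by (auto simp: words_def)
      show "word_prob p w \<le> word_prob p w * (word_mart p w)\<^sup>2 / (\<delta> * real n)\<^sup>2"
      proof (cases "word_prob p w = 0")
        case False
        then have "\<delta> * real n \<le> \<bar>word_mart p w\<bar>" using typical[of w n] w n nn by force
        then have "(\<delta> * real n)\<^sup>2 \<le> (word_mart p w)\<^sup>2" using \<delta> n by (simp add: abs_le_square_iff[symmetric])
        then have "word_prob p w * 1 \<le> word_prob p w * ((word_mart p w)\<^sup>2 / (\<delta> * real n)\<^sup>2)"
          using \<delta> n nn by (intro mult_left_mono) (auto simp: field_simps)
        then show ?thesis by simp
      qed simp
    qed
    also have "\<dots> \<le> (\<Sum>w\<in>words n. word_prob p w * (word_mart p w)\<^sup>2 / (\<delta> * real n)\<^sup>2)"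
      using word_prob_nonneg[OF p] by (intro sum_mono2 finite_words) (auto simp: words_def)
    also have "\<dots> = (\<Sum>w\<in>words n. word_prob p w * (word_mart p w)\<^sup>2) / (\<delta> * real n)\<^sup>2"
      by (simp add: sum_divide_distrib)
    also have "\<dots> \<le> real n / (\<delta> * real n)\<^sup>2"
      by (intro divide_right_mono second_moment_word_mart p) auto
    also have "\<dots> = 1 / \<delta>\<^sup>2 / real n" using n by (simp add: power2_eq_square field_simps)
    finally show ?thesis .
  qed
  have "(\<lambda>n. \<Sum>w\<in>?bad n. word_prob p w) \<longlonglongrightarrow> 0"
  proof (rule tendsto_sandwich)
    show "\<forall>\<^sub>F n in sequentially. 0 \<le> (\<Sum>w\<in>?bad n. word_prob p w)"
      using word_prob_nonneg[OF p] by (intro always_eventually allI sum_nonneg) (auto simp: words_def)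
    have "\<forall>\<^sub>F n in sequentially. 2 * K / \<eta> \<le> real n"
      using filterlim_real_sequentially by (simp add: filterlim_at_top)
    then show "\<forall>\<^sub>F n in sequentially. (\<Sum>w\<in>?bad n. word_prob p w) \<le> 1 / \<delta>\<^sup>2 / real n"
      using eventually_gt_at_top[of "0::nat"] by eventually_elim (rule bound)
    show "(\<lambda>n. 1 / \<delta>\<^sup>2 / real n) \<longlonglongrightarrow> 0" by (rule lim_const_over_n)
  qed simp
  then show ?thesis using that[of q] \<epsilon>(1) by (simp add: q_def)
qed

end

section \<open>The law of the histories\<close>

text \<open>The word formed by the first \<open>n\<close> states \<open>X 1, \<dots>, X n\<close>, latest first.\<close>

primrec history :: "(nat \<Rightarrow> 'a \<Rightarrow> nat) \<Rightarrow> nat \<Rightarrow> 'a \<Rightarrow> nat list" where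
  "history X 0 \<omega> = []"
| "history X (Suc n) \<omega> = X (Suc n) \<omega> # history X n \<omega>"

lemma length_history [simp]: "length (history X n \<omega>) = n"
  by (induction n) auto

lemma sum_list_history: "sum_list (history X n \<omega>) = partial_count X n \<omega>"
  by (induction n) (auto simp: partial_count_def)

text \<open>Translates words into the histories \<open>x\<close>, indexed from \<open>1\<close>, that the Markov property refers to.\<close>

lemma history_eq_iff:
  assumes "length w = n"
  shows "\<exists>x. (\<forall>\<omega>. history X n \<omega> = w \<longleftrightarrow> (\<forall>k\<in>{1..n}. X k \<omega> = x k)) \<and> (0 < n \<longrightarrow> x n = hd w)"
  using assms
proof (induction w arbitrary: n)
  case (Cons a w)
  then obtain m where n: "n = Suc m" "length w = m" by auto
  with Cons.IH obtain x where x: "\<And>\<omega>. history X m \<omega> = w \<longleftrightarrow> (\<forall>k\<in>{1..m}. X k \<omega> = x k)" by blast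
  have "(\<forall>k\<in>{1..n}. X k \<omega> = (x(n := a)) k) \<longleftrightarrow> X n \<omega> = a \<and> (\<forall>k\<in>{1..m}. X k \<omega> = x k)" for \<omega>
    by (auto simp: n atLeastAtMostSuc_conv)
  then show ?case using x by (intro exI[of _ "x(n := a)"]) (auto simp: n)
qed auto

context markov_chain01
begin

lemma history_in_words: "\<omega> \<in> space M \<Longrightarrow> history X n \<omega> \<in> words n"
  using X_in by (induction n) (auto simp: words_def)

lemma sets_history_eq: "{\<omega>\<in>space M. history X n \<omega> = w} \<in> events"
proof (cases "length w = n")
  case True
  have X: "X k \<in> M \<rightarrow>\<^sub>M count_space UNIV" if "k \<ge> 1" for k using X_measurable that .
  obtain x where x: "\<And>\<omega>. history X n \<omega> = w \<longleftrightarrow> (\<forall>k\<in>{1..n}. X k \<omega> = x k)"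
    using history_eq_iff[OF True, of X] by auto
  have "{\<omega>\<in>space M. X k \<omega> = x k} \<in> events" if "k \<in> {1..n}" for k
    using measurable_sets[OF X[of k], of "{x k}"] that by (simp add: vimage_def Int_def conj_commute)
  then show ?thesis unfolding x by (intro sets.sets_Collect_finite_All) auto
next
  case False
  then have "{\<omega>\<in>space M. history X n \<omega> = w} = {}" by auto
  then show ?thesis by (simp only: sets.empty_sets)
qed

lemma sets_history_mem: "B \<subseteq> words n \<Longrightarrow> {\<omega>\<in>space M. history X n \<omega> \<in> B} \<in> events"
proof -
  assume B: "B \<subseteq> words n"
  have "{\<omega>\<in>space M. history X n \<omega> \<in> B} = (\<Union>w\<in>B. {\<omega>\<in>space M. history X n \<omega> = w})" by auto
  then show ?thesis
    using finite_subset[OF B finite_words] by (auto intro: sets_history_eq)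
qed

lemma prob_history_eq:
  "w \<in> words n \<Longrightarrow> prob {\<omega>\<in>space M. history X n \<omega> = w} = word_prob p w"
proof (induction w arbitrary: n rule: induct_list012)
  case 1
  then show ?case by (simp add: words_def prob_space)
next
  case (2 a)
  then have "n = Suc 0" "a = 0 \<or> a = 1" by (auto simp: words_def)
  then show ?case using initial0 initial1 by auto
next
  case (3 b a w)
  define i where "i = length (a # w)"
  have n: "n = Suc i" "1 \<le> i" and aw: "a # w \<in> words i" and b: "b \<in> {0, 1}"
    using 3(3) by (auto simp: words_def i_def)
  note IH = 3(2)[OF aw]
  obtain x where x: "\<And>\<omega>. history X i \<omega> = a # w \<longleftrightarrow> (\<forall>k\<in>{1..i}. X k \<omega> = x k)" "x i = a"
    using history_eq_iff[of "a # w" i X] n unfolding i_def by auto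
  have eq: "{\<omega>\<in>space M. history X n \<omega> = b # a # w} =
      {\<omega>\<in>space M. X (Suc i) \<omega> = b \<and> (\<forall>k\<in>{1..i}. X k \<omega> = x k)}"
    unfolding n history.simps list.inject x(1) ..
  show ?case
  proof (cases "word_prob p (a # w) > 0")
    case True
    then have "prob {\<omega>\<in>space M. \<forall>k\<in>{1..i}. X k \<omega> = x k} > 0"
      using IH by (simp only: x(1))
    from markov[OF n(2) b this] this show ?thesis
      using IH unfolding eq cond_prob_def by (simp add: x field_simps)
  next
    case False
    \<comment> \<open>The Markov property says nothing after a history of probability \<open>0\<close>, but then both sides vanish.\<close>
    then have zero: "word_prob p (a # w) = 0"
      using IH measure_nonneg[of M] by (metis less_le)
    have "prob {\<omega>\<in>space M. history X n \<omega> = b # a # w} \<le> prob {\<omega>\<in>space M. history X i \<omega> = a # w}"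
      by (intro finite_measure_mono sets_history_eq) (auto simp: n)
    then show ?thesis using IH zero measure_nonneg[of M] by (simp add: order_antisym)
  qed
qed

lemma prob_history_mem:
  assumes "B \<subseteq> words n"
  shows "prob {\<omega>\<in>space M. history X n \<omega> \<in> B} = (\<Sum>w\<in>B. word_prob p w)"
proof -
  have "{\<omega>\<in>space M. history X n \<omega> \<in> B} = (\<Union>w\<in>B. {\<omega>\<in>space M. history X n \<omega> = w})" by auto
  also have "prob \<dots> = (\<Sum>w\<in>B. prob {\<omega>\<in>space M. history X n \<omega> = w})"
    using finite_subset[OF assms finite_words] sets_history_eq
    by (intro finite_measure_finite_Union) (auto simp: disjoint_family_on_def)
  also have "\<dots> = (\<Sum>w\<in>B. word_prob p w)"
    using assms by (intro sum.cong prob_history_eq) auto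
  finally show ?thesis .
qed

lemma geometric_sum_in_word_interval:
  assumes \<omega>: "\<omega> \<in> space M" and \<beta>: "\<beta>0 \<in> {0<..<1}" "\<beta>1 \<in> {0<..<1}"
  shows "geometric_sum X \<beta>0 \<beta>1 \<omega> \<in> word_interval \<beta>0 \<beta>1 (history X n \<omega>)"
proof -
  define t where "t j = (let i = Suc j in
        real (X i \<omega>) * \<beta>1 ^ partial_count X i \<omega> * \<beta>0 ^ (i - partial_count X i \<omega>))" for j
  have offset: "word_offset \<beta>0 \<beta>1 (history X n \<omega>) = (\<Sum>j<n. t j)" for n
  proof (induction n)
    case (Suc n)
    have "word_radius \<beta>0 \<beta>1 (history X (Suc n) \<omega>) =
        \<beta>1 ^ partial_count X (Suc n) \<omega> * \<beta>0 ^ (Suc n - partial_count X (Suc n) \<omega>)"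
      using history_in_words[OF \<omega>, of "Suc n"]
      by (subst word_radius_eq) (simp_all only: words_def mem_Collect_eq sum_list_history length_history)
    then show ?case using Suc by (simp add: t_def Let_def del: word_radius.simps)
  qed simp
  \<comment> \<open>All later partial sums stay in the closed interval of level \<open>n\<close>, hence so does their limit.\<close>
  have nested: "word_interval \<beta>0 \<beta>1 (history X (n + k) \<omega>) \<subseteq> word_interval \<beta>0 \<beta>1 (history X n \<omega>)" for k
  proof (induction k)
    case (Suc k)
    then show ?case
      using word_interval_Cons[OF \<beta> X_in[OF _ \<omega>, of "Suc (n + k)"], of "history X (n + k) \<omega>"] by auto
  qed simp
  have "summable t" unfolding t_def using geometric_sum_summable[OF \<omega> \<beta>] .
  then have "(\<lambda>k. \<Sum>j<k. t j) \<longlonglongrightarrow> geometric_sum X \<beta>0 \<beta>1 \<omega>"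
    unfolding geometric_sum_def t_def by (rule summable_LIMSEQ)
  then have "(\<lambda>k. word_offset \<beta>0 \<beta>1 (history X (n + k) \<omega>)) \<longlonglongrightarrow> geometric_sum X \<beta>0 \<beta>1 \<omega>"
    unfolding offset by (subst add.commute) (rule LIMSEQ_ignore_initial_segment)
  moreover have "word_offset \<beta>0 \<beta>1 (history X (n + k) \<omega>) \<in> word_interval \<beta>0 \<beta>1 (history X n \<omega>)" for k
    using nested[of k] mult_pos_pos[OF tail_const_pos[OF \<beta>] word_radius_pos[OF \<beta>, of "history X (n + k) \<omega>"]]
    by (auto simp: word_interval_def)
  moreover have "closed (word_interval \<beta>0 \<beta>1 (history X n \<omega>))" by (simp add: word_interval_def)
  ultimately show ?thesis
    using closed_sequentially[of "word_interval \<beta>0 \<beta>1 (history X n \<omega>)"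
        "\<lambda>k. word_offset \<beta>0 \<beta>1 (history X (n + k) \<omega>)"] by simp
qed

text \<open>The set is the limsup of the good intervals. It has full measure: if \<open>S\<close> avoids all good
  intervals of level at least \<open>N\<close>, then the history of each length \<open>n \<ge> N\<close> is bad, and the probability of
  this tends to \<open>0\<close> as \<open>n\<close> grows.\<close>

lemma full_measure_hausdorff_null:
  assumes p: "p \<in> {0<..<1}" and \<beta>: "\<beta>0 \<in> {0<..<1}" "\<beta>1 \<in> {0<..<1}"
    and s: "s > 0" "s * (ln \<beta>0 + (1 - p) * ln \<beta>1) < p * ln p + (1 - p) * ln (1 - p)"
  obtains A where "A \<in> sets borel" "emeasure (markov_geometric_measure M X \<beta>0 \<beta>1) A = 1"
    "hausdorff_outer_measure s A = 0"
proof -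
  define C where "C = tail_const \<beta>0 \<beta>1"
  have C: "C > 0" unfolding C_def by (rule tail_const_pos[OF \<beta>])
  obtain q where q: "0 < q" "q < 1" and lim:
    "(\<lambda>n. \<Sum>w\<in>{w\<in>words n. \<not> (C * word_radius \<beta>0 \<beta>1 w) powr s \<le> word_prob p w * q ^ n}. word_prob p w)
       \<longlonglongrightarrow> 0" (is "(\<lambda>n. \<Sum>w\<in>?bad n. _) \<longlonglongrightarrow> 0")
    using bad_words_negligible[OF \<beta> p s(2) C] by blast
  define G where "G = {w. w \<in> words (length w) \<and>
    (C * word_radius \<beta>0 \<beta>1 w) powr s \<le> word_prob p w * q ^ length w}"
  define A where "A N = (\<Union>w\<in>{w\<in>G. N \<le> length w}. word_interval \<beta>0 \<beta>1 w)" for N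
  have A: "A N \<in> sets borel" for N
    unfolding A_def by (intro sets.countable_UN'' countableI_type) (simp add: word_interval_def)
  let ?S = "geometric_sum X \<beta>0 \<beta>1"
  note S = geometric_sum_measurable[of \<beta>0 \<beta>1]
  have "AE \<omega> in M. ?S \<omega> \<in> A N" for N
  proof -
    have "prob {\<omega>\<in>space M. ?S \<omega> \<notin> A N} \<le> (\<Sum>w\<in>?bad n. word_prob p w)" if "N \<le> n" for n
    proof -
      have "{\<omega>\<in>space M. ?S \<omega> \<notin> A N} \<subseteq> {\<omega>\<in>space M. history X n \<omega> \<in> ?bad n}"
      proof clarify
        fix \<omega> assume \<omega>: "\<omega> \<in> space M" and notin: "?S \<omega> \<notin> A N"
        have "history X n \<omega> \<notin> G"
          using notin geometric_sum_in_word_interval[OF \<omega> \<beta>, of n] that by (auto simp: A_def)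
        then show "history X n \<omega> \<in> words n \<and>
          \<not> (C * word_radius \<beta>0 \<beta>1 (history X n \<omega>)) powr s \<le> word_prob p (history X n \<omega>) * q ^ n"
          using history_in_words[OF \<omega>, of n] by (simp add: G_def)
      qed
      then have "prob {\<omega>\<in>space M. ?S \<omega> \<notin> A N} \<le> prob {\<omega>\<in>space M. history X n \<omega> \<in> ?bad n}"
        by (intro finite_measure_mono sets_history_mem) auto
      also have "\<dots> = (\<Sum>w\<in>?bad n. word_prob p w)" by (intro prob_history_mem) auto
      finally show ?thesis .
    qed
    then have "prob {\<omega>\<in>space M. ?S \<omega> \<notin> A N} \<le> 0"
      by (intro LIMSEQ_le_const[OF lim]) auto
    then have "prob {\<omega>\<in>space M. ?S \<omega> \<notin> A N} = 0" using measure_nonneg[of M] by (simp add: order_antisym)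
    moreover have "{\<omega>\<in>space M. ?S \<omega> \<notin> A N} \<in> events" using S A by measurable
    ultimately show ?thesis by (intro AE_I[of _ _ "{\<omega>\<in>space M. ?S \<omega> \<notin> A N}"]) (auto simp: emeasure_eq_measure)
  qed
  then have ae: "AE \<omega> in M. ?S \<omega> \<in> (\<Inter>N. A N)" by (simp add: AE_all_countable)
  have sets: "(\<Inter>N. A N) \<in> sets borel" using A by auto
  have "emeasure (markov_geometric_measure M X \<beta>0 \<beta>1) (\<Inter>N. A N) = emeasure M {\<omega>\<in>space M. ?S \<omega> \<in> (\<Inter>N. A N)}"
    unfolding markov_geometric_measure_def by (subst emeasure_distr[OF S sets]) (auto intro!: arg_cong[where f = "emeasure M"])
  also have "\<dots> = 1"
  proof (rule emeasure_eq_1_AE)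
    show "{\<omega>\<in>space M. ?S \<omega> \<in> (\<Inter>N. A N)} \<in> events"
      using measurable_sets[OF S sets] by (simp add: vimage_def Int_def conj_commute)
    show "AE \<omega> in M. \<omega> \<in> {\<omega>\<in>space M. ?S \<omega> \<in> (\<Inter>N. A N)}"
      using ae AE_space by eventually_elim simp
  qed
  finally have full: "emeasure (markov_geometric_measure M X \<beta>0 \<beta>1) (\<Inter>N. A N) = 1" .
  have "hausdorff_outer_measure s (\<Inter>N. A N) = 0"
  proof (rule hausdorff_null_limsup[where I = "word_interval \<beta>0 \<beta>1" and len = length and G = G
        and q = q and K = C and m = "max \<beta>0 \<beta>1"])
    fix n
    have sub: "{w\<in>G. length w = n} \<subseteq> words n" by (auto simp: G_def)
    then show "finite {w\<in>G. length w = n}" using finite_subset finite_words by blast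
    have "(\<Sum>w\<in>{w\<in>G. length w = n}. diam_pow s (word_interval \<beta>0 \<beta>1 w))
        \<le> (\<Sum>w\<in>{w\<in>G. length w = n}. word_prob p w * q ^ n)"
      by (intro sum_mono) (auto simp: diam_pow_word_interval[OF \<beta> s(1)] G_def C_def)
    also have "\<dots> \<le> (\<Sum>w\<in>words n. word_prob p w * q ^ n)"

    proof (rule sum_mono2[OF finite_words sub])
      fix w assume "w \<in> words n - {w\<in>G. length w = n}"
      then show "0 \<le> word_prob p w * q ^ n" using q word_prob_nonneg[OF p] by (simp add: words_def)
    qed
    also have "\<dots> = q ^ n" by (simp add: sum_distrib_right[symmetric] sum_word_prob[OF p])
    finally show "(\<Sum>w\<in>{w\<in>G. length w = n}. diam_pow s (word_interval \<beta>0 \<beta>1 w)) \<le> q ^ n" .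
  next
    fix w
    show "diameter (word_interval \<beta>0 \<beta>1 w) \<le> C * max \<beta>0 \<beta>1 ^ length w"
      using C word_radius_le[OF \<beta>, of w] by (simp add: diameter_word_interval[OF \<beta>] C_def)
    show "bounded (word_interval \<beta>0 \<beta>1 w)" by (simp add: word_interval_def)
  next
    show "(\<Inter>N. A N) \<subseteq> (\<Union>w\<in>{w\<in>G. N \<le> length w}. word_interval \<beta>0 \<beta>1 w)" for N
      by (auto simp: A_def)
  qed (use q \<beta> in auto)
  with sets full show ?thesis by (rule that)
qed

end

section \<open>Singularity and the dimension bound\<close>

theorem theorem3p1:
  fixes M :: "'a measure" and X :: "nat \<Rightarrow> 'a \<Rightarrow> nat" and \<beta>0 \<beta>1 p :: real
  assumes "\<beta>0 \<in> {0<..<1}" and "\<beta>1 \<in> {0<..<1}" and "p \<in> {0<..<1}"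
    and "markov_chain01 M X p"
    and "\<beta>0 * \<beta>1 powr (1 - p) < p powr p * (1 - p) powr (1 - p)"
  shows "lebesgue_singular (markov_geometric_measure M X \<beta>0 \<beta>1) \<and>
    measure_hausdorff_dim (markov_geometric_measure M X \<beta>0 \<beta>1)
      \<le> ereal ((p * ln p + (1 - p) * ln (1 - p)) / (ln \<beta>0 + (1 - p) * ln \<beta>1))"
proof
  interpret markov_chain01 M X p by fact
  note \<beta> = assms(1,2) and p = assms(3)
  let ?\<mu> = "markov_geometric_measure M X \<beta>0 \<beta>1"
  define E L where EL: "E = p * ln p + (1 - p) * ln (1 - p)" "L = ln \<beta>0 + (1 - p) * ln \<beta>1"
  have E: "E < 0" and L: "L < 0"
    using p \<beta> by (auto simp: EL intro!: add_neg_neg mult_pos_neg)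
  have "ln (\<beta>0 * \<beta>1 powr (1 - p)) < ln (p powr p * (1 - p) powr (1 - p))"
    using assms(5) p \<beta> by (subst ln_less_cancel_iff) auto
  then have LE: "L < E" using p \<beta> by (simp add: EL ln_mult ln_powr)
  obtain B where B: "B \<in> sets borel" "emeasure ?\<mu> B = 1" "hausdorff_outer_measure 1 B = 0"
    using full_measure_hausdorff_null[OF p \<beta>, of 1] LE by (auto simp: EL)
  then show "lebesgue_singular ?\<mu>"
    unfolding lebesgue_singular_def using hausdorff_null_imp_lborel_null by blast
  have "measure_hausdorff_dim ?\<mu> \<le> ereal s" if s: "E / L < s" for s
  proof -
    have s0: "0 < s" using s E L by (meson divide_neg_neg less_trans)
    have "s * L < E" using s L by (simp add: neg_divide_less_eq)
    with s0 obtain A where A: "A \<in> sets borel" "emeasure ?\<mu> A = 1" "hausdorff_outer_measure s A = 0"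
      using full_measure_hausdorff_null[OF p \<beta>, of s] unfolding EL by blast
    have "measure_hausdorff_dim ?\<mu> \<le> hausdorff_dim A"
      unfolding measure_hausdorff_dim_def using A
      by (intro Inf_lower) (auto simp: markov_geometric_measure_def)
    also have "\<dots> \<le> ereal s"
      unfolding hausdorff_dim_def using A s0 by (intro Inf_lower) auto
    finally show ?thesis .
  qed
  then have "measure_hausdorff_dim ?\<mu> \<le> ereal (E / L) + ereal e" if "0 < e" for e
    using that by simp
  then have "measure_hausdorff_dim ?\<mu> \<le> ereal (E / L)"
    by (rule ereal_le_epsilon2)
  then show "measure_hausdorff_dim ?\<mu>
      \<le> ereal ((p * ln p + (1 - p) * ln (1 - p)) / (ln \<beta>0 + (1 - p) * ln \<beta>1))"
    by (simp add: EL)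
qed

end
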